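(* Given any compact subset $E\subset\mathbb{R}^d$ and any $\epsilon>0$, there is a generic orthotope $P$ (of dimension $d$, in $\mathbb{R}^d$) such that $\mathrm{Hdist}(E,P)<\epsilon$.
   Context: Here $d$ is a non-negative integer. **Hausdorff distance.** For a pair $P,Q\subset\mathbb{R}^d$ of compact subsets, $\mathrm{Hdist}(P,Q)=\max\{\sup_{p\in P}d(p,Q),\ \sup_{q\in Q}d(q,P)\}$, where $d(x,P)=\inf_{p\in P}\|x-p\|_\infty$. **Floral vertices.** A series-parallel diagram (SPD) is defined inductively as a single edge joining two terminals, a series connection $\Delta_1\wedge\Delta_2$ of SPDs, or a parallel connection $\Delta_1\vee\Delta_2$ of SPDs; the edges are all distinct (so an SPD is a read-once formula in $\wedge,\vee$). The single vertex is also admitted as an SPD, with no edges. A signed SPD is a pair $(\Delta,s)$ with $s:E(\Delta)\to\{\pm1\}$, where $E(\Delta)$ is the edge set. Let $H_i=\{x\in\mathbb{R}^d: x_i\ge 0\}$. If $E(\Delta)=\{1,\dots,d\}$, the floral vertex in $\mathbb{R}^d$ determined by $(\Delta,s)$ is the set obtained by interpreting edge $i$ as $s_iH_i$, series connection as intersection and parallel connection as union (for $d=0$, the diagram with no edges gives the point $\mathbb{R}^0$). **Orthogonal polytopes.** An axis-aligned box is a product $\prod_{i=1}^d[a_i,b_i]$ with $a_i\le b_i$; it is pure $d$-dimensional if all $a_i<b_i$. A pure $d$-dimensional orthogonal polytope is a union of a finite set of pure $d$-dimensional axis-aligned boxes. For $s\in\{\pm1\}^d$ the orthant $\Omega_s$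 is $\{x: s_ix_i\ge0\ \forall i\}$; a local orthotopal arrangement is a union of orthants. The tangent cone of $P$ at $v\in P$ is the local orthotopal arrangement $\alpha$ such that for some $\delta>0$, $P\cap(v+[-\delta,\delta]^d)=v+(\alpha\cap[-\delta,\delta]^d)$. The genericity region of $v\in P$ is the set of points of $P$ joined to $v$ by a path along which every tangent cone is congruent (under signed coordinate permutations) to the one at $v$. Its degree is the smallest dimension of a set of the form $\{x:x_i=\lambda_i\ \forall i\in I\}$ ($I\subset\{1,\dots,d\}$) containing it. A point is singular (a vertex of $P$) if its genericity region has degree $0$. **Generic orthotope.** A generic orthotope of dimension $d$ is a pure $d$-dimensional orthogonal polytope in $\mathbb{R}^d$ such that the tangent cone at every singular point is a floral vertex on $d$ half-spaces. *)

theory Defs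
  imports "HOL-Analysis.Analysis"
begin

text \<open>
  The space \<open>\<real>\<^sup>d\<close>, for arbitrary \<open>d \<ge> 0\<close>, is \<^term>\<open>Euclidean_space d\<close>: points are
  functions \<open>nat \<Rightarrow> real\<close> vanishing at all indices \<open>\<ge> d\<close>. Coordinates are numbered from \<open>0\<close> to
  \<open>d - 1\<close>.
\<close>

type_synonym point = "nat \<Rightarrow> real"

abbreviation RR :: "nat \<Rightarrow> point set" where
  "RR d \<equiv> topspace (Euclidean_space d)"

definition translate :: "point \<Rightarrow> point set \<Rightarrow> point set" where
  "translate v S = (\<lambda>x i. v i + x i) ` S"

text \<open>Sign vectors; only the first \<open>d\<close> entries matter.\<close>

definition is_sign :: "nat \<Rightarrow> (nat \<Rightarrow> real) \<Rightarrow> bool" where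
  "is_sign d s \<longleftrightarrow> (\<forall>i<d. s i \<in> {-1, 1})"

subsection \<open>Hausdorff distance\<close>

text \<open>Inserting \<open>0\<close> changes the maximum only when \<open>d = 0\<close>.\<close>

definition sup_norm :: "nat \<Rightarrow> point \<Rightarrow> real" where
  "sup_norm d x = Max (insert 0 ((\<lambda>i. \<bar>x i\<bar>) ` {..<d}))"

text \<open>
  Distances take values in \<^typ>\<open>ennreal\<close>, so that \<open>inf \<emptyset> = \<infinity>\<close> and \<open>sup \<emptyset> = 0\<close>:
  the empty set is at distance \<open>0\<close> from itself and \<open>\<infinity>\<close> from every nonempty set.
\<close>

definition set_dist :: "nat \<Rightarrow> point \<Rightarrow> point set \<Rightarrow> ennreal" where
  "set_dist d x P = (INF p\<in>P. ennreal (sup_norm d (\<lambda>i. x i - p i)))"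

definition Hdist :: "nat \<Rightarrow> point set \<Rightarrow> point set \<Rightarrow> ennreal" where
  "Hdist d P Q = max (SUP p\<in>P. set_dist d p Q) (SUP q\<in>Q. set_dist d q P)"

subsection \<open>Floral vertices\<close>

text \<open>
  Series-parallel diagrams are represented by their formation trees. The single vertex is
  admitted only on its own, not as a part of a series or parallel connection.
\<close>

datatype 'e diagram =
    Vertex
  | Edge 'e
  | Series "'e diagram" "'e diagram"
  | Parallel "'e diagram" "'e diagram"

fun edges :: "'e diagram \<Rightarrow> 'e set" where
  "edges Vertex = {}"
| "edges (Edge e) = {e}"
| "edges (Series \<Delta>1 \<Delta>2) = edges \<Delta>1 \<union> edges \<Delta>2"
| "edges (Parallel \<Delta>1 \<Delta>2) = edges \<Delta>1 \<union> edges \<Delta>2"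

inductive proper_spd :: "'e diagram \<Rightarrow> bool" where
  "proper_spd (Edge e)"
| "proper_spd \<Delta>1 \<Longrightarrow> proper_spd \<Delta>2 \<Longrightarrow> edges \<Delta>1 \<inter> edges \<Delta>2 = {} \<Longrightarrow> proper_spd (Series \<Delta>1 \<Delta>2)"
| "proper_spd \<Delta>1 \<Longrightarrow> proper_spd \<Delta>2 \<Longrightarrow> edges \<Delta>1 \<inter> edges \<Delta>2 = {} \<Longrightarrow> proper_spd (Parallel \<Delta>1 \<Delta>2)"

definition spd :: "'e diagram \<Rightarrow> bool" where
  "spd \<Delta> \<longleftrightarrow> \<Delta> = Vertex \<or> proper_spd \<Delta>"

definition half_space :: "nat \<Rightarrow> nat \<Rightarrow> point set" where
  "half_space d i = {x \<in> RR d. 0 \<le> x i}"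

fun interp :: "nat \<Rightarrow> (nat \<Rightarrow> real) \<Rightarrow> nat diagram \<Rightarrow> point set" where
  "interp d s Vertex = RR d"
| "interp d s (Edge i) = (\<lambda>x j. s i * x j) ` half_space d i"
| "interp d s (Series \<Delta>1 \<Delta>2) = interp d s \<Delta>1 \<inter> interp d s \<Delta>2"
| "interp d s (Parallel \<Delta>1 \<Delta>2) = interp d s \<Delta>1 \<union> interp d s \<Delta>2"

text \<open>Since \<open>edges \<Delta> = {..<d}\<close>, the diagram \<^const>\<open>Vertex\<close> occurs here exactly when \<open>d = 0\<close>.\<close>

definition floral_vertex :: "nat \<Rightarrow> point set \<Rightarrow> bool" where
  "floral_vertex d \<alpha> \<longleftrightarrow>
     (\<exists>\<Delta> s. spd \<Delta> \<and> edges \<Delta> = {..<d} \<and> is_sign d s \<and> \<alpha> = interp d s \<Delta>)"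

subsection \<open>Orthogonal polytopes and tangent cones\<close>

definition axis_box :: "nat \<Rightarrow> point \<Rightarrow> point \<Rightarrow> point set" where
  "axis_box d a b = {x \<in> RR d. \<forall>i<d. a i \<le> x i \<and> x i \<le> b i}"

definition pure_box :: "nat \<Rightarrow> point set \<Rightarrow> bool" where
  "pure_box d B \<longleftrightarrow> (\<exists>a b. (\<forall>i<d. a i < b i) \<and> B = axis_box d a b)"

definition pure_orthogonal_polytope :: "nat \<Rightarrow> point set \<Rightarrow> bool" where
  "pure_orthogonal_polytope d P \<longleftrightarrow> (\<exists>\<B>. finite \<B> \<and> (\<forall>B\<in>\<B>. pure_box d B) \<and> P = \<Union>\<B>)"

definition orthant :: "nat \<Rightarrow> (nat \<Rightarrow> real) \<Rightarrow> point set" where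
  "orthant d s = {x \<in> RR d. \<forall>i<d. 0 \<le> s i * x i}"

definition local_arrangement :: "nat \<Rightarrow> point set \<Rightarrow> bool" where
  "local_arrangement d \<alpha> \<longleftrightarrow> (\<exists>S. (\<forall>s\<in>S. is_sign d s) \<and> \<alpha> = (\<Union>s\<in>S. orthant d s))"

definition cube :: "nat \<Rightarrow> real \<Rightarrow> point set" where
  "cube d \<delta> = axis_box d (\<lambda>_. - \<delta>) (\<lambda>_. \<delta>)"

text \<open>
  The tangent cone is introduced as a relation rather than a function; lemma
  \<open>has_tangent_cone_unique\<close> below shows that it is single-valued.
\<close>

definition has_tangent_cone :: "nat \<Rightarrow> point set \<Rightarrow> point \<Rightarrow> point set \<Rightarrow> bool" where
  "has_tangent_cone d P v \<alpha> \<longleftrightarrow> local_arrangement d \<alpha> \<and>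
     (\<exists>\<delta>>0. P \<inter> translate v (cube d \<delta>) = translate v (\<alpha> \<inter> cube d \<delta>))"

lemma local_arrangement_scale:
  assumes "local_arrangement d \<alpha>" "t > 0"
  shows "(\<lambda>i. t * x i) \<in> \<alpha> \<longleftrightarrow> x \<in> \<alpha>"
proof -
  have "0 \<le> c * (t * z) \<longleftrightarrow> 0 \<le> c * z" for c z :: real
    using assms(2) by (simp add: mult.left_commute[of c t] zero_le_mult_iff)
  with assms show ?thesis
    by (auto simp: local_arrangement_def orthant_def topspace_Euclidean_space)
qed

lemma has_tangent_cone_unique:
  assumes "has_tangent_cone d P v \<alpha>" "has_tangent_cone d P v \<beta>"
  shows "\<alpha> = \<beta>"
proof -
  have sub: "\<alpha> \<subseteq> \<beta>"
    if A: "has_tangent_cone d P v \<alpha>" and B: "has_tangent_cone d P v \<beta>" for \<alpha> \<beta>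
  proof
    fix x assume x: "x \<in> \<alpha>"
    obtain \<delta> where \<delta>: "\<delta> > 0" "P \<inter> translate v (cube d \<delta>) = translate v (\<alpha> \<inter> cube d \<delta>)"
      using A by (auto simp: has_tangent_cone_def)
    obtain \<epsilon> where \<epsilon>: "\<epsilon> > 0" "P \<inter> translate v (cube d \<epsilon>) = translate v (\<beta> \<inter> cube d \<epsilon>)"
      using B by (auto simp: has_tangent_cone_def)
    have LA: "local_arrangement d \<alpha>" "local_arrangement d \<beta>"
      using A B by (auto simp: has_tangent_cone_def)
    then have xR: "x \<in> RR d"
      using x by (auto simp: local_arrangement_def orthant_def)
    define M where "M = 1 + (\<Sum>i<d. \<bar>x i\<bar>)"
    have M: "M > 0" by (simp add: M_def add_pos_nonneg sum_nonneg)
    have xM: "\<bar>x i\<bar> \<le> M" if "i < d" for i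
      using member_le_sum[of i "{..<d}" "\<lambda>i. \<bar>x i\<bar>"] that by (simp add: M_def)
    define t where "t = min \<delta> \<epsilon> / M"
    have t: "t > 0" "t * M = min \<delta> \<epsilon>" using \<delta> \<epsilon> M by (auto simp: t_def)
    define y where "y = (\<lambda>i. t * x i)"
    have "\<bar>y i\<bar> \<le> min \<delta> \<epsilon>" if "i < d" for i
      using mult_left_mono[OF xM[OF that], of t] t by (simp add: y_def abs_mult)
    moreover have "y \<in> RR d" using xR by (auto simp: y_def topspace_Euclidean_space)
    ultimately have y: "y \<in> cube d \<delta>" "y \<in> cube d \<epsilon>"
      by (auto simp: cube_def axis_box_def abs_le_iff) (smt (verit))+
    have "y \<in> \<alpha>" using local_arrangement_scale[OF LA(1) t(1)] x by (simp add: y_def)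
    then have "(\<lambda>i. v i + y i) \<in> P \<inter> translate v (cube d \<epsilon>)"
      using \<delta>(2) y by (auto simp: translate_def)
    then have "(\<lambda>i. v i + y i) \<in> translate v (\<beta> \<inter> cube d \<epsilon>)"
      using \<epsilon>(2) by simp
    then obtain z where z: "z \<in> \<beta>" "(\<lambda>i. v i + y i) = (\<lambda>i. v i + z i)"
      by (auto simp: translate_def)
    then have "y = z" by (simp add: fun_eq_iff)
    with z have "y \<in> \<beta>" by simp
    then show "x \<in> \<beta>" using local_arrangement_scale[OF LA(2) t(1)] by (simp add: y_def)
  qed
  show ?thesis using sub assms by blast
qed

definition cone_congruent :: "nat \<Rightarrow> point set \<Rightarrow> point set \<Rightarrow> bool" where
  "cone_congruent d \<alpha> \<beta> \<longleftrightarrow>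
     (\<exists>\<pi> s. \<pi> permutes {..<d} \<and> is_sign d s \<and> \<beta> = (\<lambda>x i. s i * x (\<pi> i)) ` \<alpha>)"

subsection \<open>Generic orthotopes\<close>

definition genericity_region :: "nat \<Rightarrow> point set \<Rightarrow> point \<Rightarrow> point set" where
  "genericity_region d P v =
     {p \<in> P. \<exists>g. pathin (subtopology (Euclidean_space d) P) g \<and> g 0 = v \<and> g 1 = p \<and>
        (\<forall>t\<in>{0..1}. \<exists>\<alpha> \<beta>. has_tangent_cone d P v \<alpha> \<and> has_tangent_cone d P (g t) \<beta> \<and>
           cone_congruent d \<alpha> \<beta>)}"

definition coord_flat :: "nat \<Rightarrow> nat set \<Rightarrow> (nat \<Rightarrow> real) \<Rightarrow> point set" where
  "coord_flat d I l = {x \<in> RR d. \<forall>i\<in>I. x i = l i}"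

text \<open>For \<open>I \<subseteq> {..<d}\<close>, the set \<^term>\<open>coord_flat d I l\<close> has dimension \<open>d - card I\<close>.\<close>

definition degree_in :: "nat \<Rightarrow> point set \<Rightarrow> point \<Rightarrow> nat" where
  "degree_in d P v =
     (LEAST k. \<exists>I l. I \<subseteq> {..<d} \<and> k = d - card I \<and> genericity_region d P v \<subseteq> coord_flat d I l)"

definition singular :: "nat \<Rightarrow> point set \<Rightarrow> point \<Rightarrow> bool" where
  "singular d P v \<longleftrightarrow> v \<in> P \<and> degree_in d P v = 0"

definition generic_orthotope :: "nat \<Rightarrow> point set \<Rightarrow> bool" where
  "generic_orthotope d P \<longleftrightarrow> pure_orthogonal_polytope d P \<and>
     (\<forall>v. singular d P v \<longrightarrow> (\<exists>\<alpha>. has_tangent_cone d P v \<alpha> \<and> floral_vertex d \<alpha>))"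

end

(* A compact set is approximated by a finite net of itself, and the net by pairwise
   disjoint small cubes centred at its points. Near each of its points such a union
   looks like a single box, whose tangent cone at a point depends only on which of the
   coordinates are extremal. If some coordinate is not extremal, it can be moved without
   changing the cone, so the point is not singular; hence the singular points are corners,
   where the tangent cone is an orthant, i.e. a series connection of d edges. *)
theory Submission
  imports Defs
begin

section \<open>Coordinates of the ambient space, and orthants as floral vertices\<close>

lemma RR_iff: "x \<in> RR d \<longleftrightarrow> (\<forall>i\<ge>d. x i = 0)"
  by (simp add: topspace_Euclidean_space)

text \<open>\<open>Vertex\<close> is admissible only on its own, so longer series are built on
  \<open>Edge 0\<close>, and \<open>Vertex\<close> is left to the case of no edges.\<close>

fun series_diagram :: "nat \<Rightarrow> nat diagram" where
  "series_diagram 0 = Vertex"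
| "series_diagram (Suc 0) = Edge 0"
| "series_diagram (Suc (Suc n)) = Series (series_diagram (Suc n)) (Edge (Suc n))"

lemma edges_series_diagram: "edges (series_diagram n) = {..<n}"
  by (induction n rule: series_diagram.induct) (simp_all add: lessThan_Suc)

lemma spd_series_diagram: "spd (series_diagram n)"
proof (cases n)
  case (Suc m)
  have "proper_spd (series_diagram (Suc m))"
    by (induction m) (auto intro: proper_spd.intros simp: edges_series_diagram)
  then show ?thesis by (simp add: Suc spd_def)
qed (simp add: spd_def)

text \<open>The interpretation multiplies all coordinates by \<open>s i\<close>, not only the one
  numbered \<open>i\<close>. As \<open>s i\<close> is its own inverse, this map is an involution, so
  the image of the half space is its preimage.\<close>

lemma interp_Edge:
  assumes "is_sign d s" "i < d"
  shows "interp d s (Edge i) = {x \<in> RR d. 0 \<le> s i * x i}"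
proof
  have s: "s i * s i = 1" using assms by (auto simp: is_sign_def)
  then have s': "s i * (s i * z) = z" for z by (simp flip: mult.assoc)
  show "interp d s (Edge i) \<subseteq> {x \<in> RR d. 0 \<le> s i * x i}"
    by (auto simp: half_space_def RR_iff s')
  show "{x \<in> RR d. 0 \<le> s i * x i} \<subseteq> interp d s (Edge i)"
  proof
    fix x assume "x \<in> {x \<in> RR d. 0 \<le> s i * x i}"
    then have "(\<lambda>j. s i * x j) \<in> half_space d i"
      by (auto simp: half_space_def RR_iff)
    then show "x \<in> interp d s (Edge i)"
      unfolding interp.simps by (rule rev_image_eqI) (simp add: s')
  qed
qed

lemma interp_series_diagram:
  assumes "is_sign d s" "n \<le> d"
  shows "interp d s (series_diagram n) = {x \<in> RR d. \<forall>i<n. 0 \<le> s i * x i}"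
  using assms(2)
proof (induction n rule: series_diagram.induct)
  case 2
  then show ?case using interp_Edge[OF assms(1), of 0] by auto
next
  case (3 n)
  then show ?case using interp_Edge[OF assms(1), of "Suc n"]
    by (auto simp: less_Suc_eq simp del: interp.simps(2))
qed auto

lemma floral_vertex_orthant:
  assumes "is_sign d s"
  shows "floral_vertex d (orthant d s)"
  unfolding floral_vertex_def orthant_def
  by (intro exI[of _ "series_diagram d"] exI[of _ s])
    (simp add: assms spd_series_diagram edges_series_diagram interp_series_diagram)

section \<open>The tangent cones of a single box\<close>

definition box_cone :: "nat \<Rightarrow> point \<Rightarrow> point \<Rightarrow> point \<Rightarrow> point set" where
  "box_cone d a b v =
     {x \<in> RR d. \<forall>i<d. (v i = a i \<longrightarrow> 0 \<le> x i) \<and> (v i = b i \<longrightarrow> x i \<le> 0)}"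

text \<open>Signs are forced at the extremal coordinates of \<open>v\<close> and free at the others;
  the cone is the union of the orthants over all sign vectors of this kind. Since
  \<open>a i < b i\<close>, no coordinate is forced both ways.\<close>

lemma local_arrangement_box_cone:
  assumes "\<forall>i<d. a i < b i"
  shows "local_arrangement d (box_cone d a b v)"
proof -
  define S where
    "S = {s. is_sign d s \<and> (\<forall>i<d. (v i = a i \<longrightarrow> s i = 1) \<and> (v i = b i \<longrightarrow> s i = -1))}"
  have "box_cone d a b v = (\<Union>s\<in>S. orthant d s)"
  proof
    show "(\<Union>s\<in>S. orthant d s) \<subseteq> box_cone d a b v"
      by (force simp: S_def orthant_def box_cone_def)
    show "box_cone d a b v \<subseteq> (\<Union>s\<in>S. orthant d s)"
    proof
      fix x assume x: "x \<in> box_cone d a b v"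
      \<comment> \<open>At a free coordinate the sign follows \<open>x\<close>, with 1 as the
        default when \<open>x i = 0\<close>.\<close>
      define s :: "nat \<Rightarrow> real" where
        "s i = (if v i = a i then 1 else if v i = b i then -1 else if 0 \<le> x i then 1 else -1)" for i
      have "s \<in> S" using assms by (auto simp: S_def is_sign_def s_def)
      moreover have "x \<in> orthant d s"
        using x by (auto simp: orthant_def box_cone_def s_def)
      ultimately show "x \<in> (\<Union>s\<in>S. orthant d s)" by blast
    qed
  qed
  moreover have "\<forall>s\<in>S. is_sign d s" by (simp add: S_def)
  ultimately show ?thesis unfolding local_arrangement_def by (intro exI[of _ S] conjI)
qed

text \<open>At a corner every coordinate is constrained on exactly one side, so a single sign vector
  remains.\<close>

lemma box_cone_corner:
  assumes "\<forall>i<d. a i < b i" "\<forall>i<d. v i = a i \<or> v i = b i"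
  shows "floral_vertex d (box_cone d a b v)"
proof -
  define s :: "nat \<Rightarrow> real" where "s i = (if v i = a i then 1 else -1)" for i
  have "0 \<le> s i * z \<longleftrightarrow> (v i = a i \<longrightarrow> 0 \<le> z) \<and> (v i = b i \<longrightarrow> z \<le> 0)" if "i < d" for i z
    using assms that by (cases "v i = a i") (auto simp: s_def)
  then have "box_cone d a b v = orthant d s"
    by (auto simp: box_cone_def orthant_def)
  moreover have "is_sign d s" by (simp add: is_sign_def s_def)
  ultimately show ?thesis using floral_vertex_orthant by simp
qed

lemma mem_translate_iff:
  "y \<in> translate v S \<longleftrightarrow> (\<lambda>i. y i - v i) \<in> S"
proof
  assume "(\<lambda>i. y i - v i) \<in> S"
  then show "y \<in> translate v S"
    unfolding translate_def by (rule rev_image_eqI) simp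
qed (auto simp: translate_def)

text \<open>In a cube around \<open>v\<close> smaller than its distance to every facet hyperplane
  that misses \<open>v\<close>, only the facets through \<open>v\<close> are felt, and these are the
  constraints of \<open>box_cone\<close>.\<close>

lemma has_tangent_cone_box:
  assumes ab: "\<forall>i<d. a i < b i" and v: "v \<in> axis_box d a b" and \<delta>: "\<delta> > 0"
    and P: "P \<inter> translate v (cube d \<delta>) = axis_box d a b \<inter> translate v (cube d \<delta>)"
  shows "has_tangent_cone d P v (box_cone d a b v)"
proof -
  \<comment> \<open>Each condition holds for all small positive \<open>r\<close>, hence so do the
    finitely many together; this replaces a minimum of distances, which could range over an empty
    set.\<close>
  have "\<forall>\<^sub>F r in at_right 0. \<forall>i<d. (v i = a i \<or> r \<le> v i - a i) \<and> (v i = b i \<or> r \<le> b i - v i)"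
  proof -
    have ev: "\<forall>\<^sub>F r in at_right 0. z = 0 \<or> r \<le> z" if "z \<ge> 0" for z :: real
    proof (cases "z = 0")
      case False
      then show ?thesis
        using that by (intro eventually_at_rightI[of 0 z]) auto
    qed simp
    have "\<forall>\<^sub>F r in at_right 0. (v i = a i \<or> r \<le> v i - a i) \<and> (v i = b i \<or> r \<le> b i - v i)"
      if "i < d" for i
    proof -
      have "0 \<le> v i - a i" "0 \<le> b i - v i" using v that by (auto simp: axis_box_def)
      from eventually_conj[OF ev[OF this(1)] ev[OF this(2)]] show ?thesis
        by eventually_elim auto
    qed
    then have "\<forall>\<^sub>F r in at_right 0. \<forall>i\<in>{..<d}.
        (v i = a i \<or> r \<le> v i - a i) \<and> (v i = b i \<or> r \<le> b i - v i)"
      by (intro eventually_ball_finite) auto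
    then show ?thesis by (simp add: Ball_def)
  qed
  moreover have "\<forall>\<^sub>F r in at_right 0. r \<in> {0<..<\<delta>}"
    using \<delta> by (rule eventually_at_right_real)
  ultimately have "\<forall>\<^sub>F r in at_right 0.
      r \<in> {0<..<\<delta>} \<and> (\<forall>i<d. (v i = a i \<or> r \<le> v i - a i) \<and> (v i = b i \<or> r \<le> b i - v i))"
    by eventually_elim auto
  from eventually_happens'[OF trivial_limit_at_right_real this]
  obtain r where r: "0 < r" "r < \<delta>"
      and ra: "\<And>i. i < d \<Longrightarrow> v i = a i \<or> r \<le> v i - a i"
      and rb: "\<And>i. i < d \<Longrightarrow> v i = b i \<or> r \<le> b i - v i"
    by auto
  have "translate v (cube d r) \<subseteq> translate v (cube d \<delta>)"
  proof
    fix y assume y: "y \<in> translate v (cube d r)"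
    have "- \<delta> \<le> y i - v i \<and> y i - v i \<le> \<delta>" if "i < d" for i
    proof -
      have "- r \<le> y i - v i" "y i - v i \<le> r"
        using y that unfolding mem_translate_iff cube_def axis_box_def by blast+
      then show ?thesis using r by linarith
    qed
    then show "y \<in> translate v (cube d \<delta>)"
      using y unfolding mem_translate_iff cube_def axis_box_def by blast
  qed
  then have "P \<inter> translate v (cube d r) = axis_box d a b \<inter> translate v (cube d r)"
    using P by blast
  also have "\<dots> = translate v (box_cone d a b v \<inter> cube d r)"
  proof (rule set_eqI)
    fix y
    \<comment> \<open>A bound that is not attained at \<open>v\<close> is at distance at least
      \<open>r\<close>, so it holds automatically; an attained bound becomes a sign condition on
      \<open>y i - v i\<close>.\<close>
    have "a i \<le> y i \<and> y i \<le> b i \<longleftrightarrow>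
        (v i = a i \<longrightarrow> 0 \<le> y i - v i) \<and> (v i = b i \<longrightarrow> y i - v i \<le> 0)"
      if "i < d" "- r \<le> y i - v i" "y i - v i \<le> r" for i
    proof -
      have "a i \<le> v i" "v i \<le> b i" using v that(1) by (auto simp: axis_box_def)
      then show ?thesis using that(2,3) ra[OF that(1)] rb[OF that(1)] by linarith
    qed
    moreover have "y \<in> RR d \<longleftrightarrow> (\<lambda>i. y i - v i) \<in> RR d"
      using v by (auto simp: axis_box_def RR_iff)
    ultimately show "y \<in> axis_box d a b \<inter> translate v (cube d r) \<longleftrightarrow>
        y \<in> translate v (box_cone d a b v \<inter> cube d r)"
      unfolding mem_translate_iff Int_iff axis_box_def cube_def box_cone_def by blast
  qed
  finally show ?thesis
    using r local_arrangement_box_cone[OF ab] unfolding has_tangent_cone_def by blast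
qed

section \<open>Genericity regions and singular points\<close>

lemma cone_congruent_refl: "cone_congruent d \<alpha> \<alpha>"
  unfolding cone_congruent_def
  by (rule exI[of _ id], rule exI[of _ "\<lambda>_. 1"]) (simp add: permutes_id is_sign_def)

text \<open>The topology is inherited from a product, so continuity is checked coordinatewise:
  coordinate \<open>j\<close> is affine in \<open>t\<close>, the others are constant.\<close>

lemma pathin_coordinate_segment:
  assumes "\<And>t. t \<in> {0..1} \<Longrightarrow> v(j := v j + t * h) \<in> P" "P \<subseteq> RR d"
  shows "pathin (subtopology (Euclidean_space d) P) (\<lambda>t. v(j := v j + t * h))"
proof -
  have "continuous_map (top_of_set {0..1}) euclideanreal (\<lambda>t. (v(j := v j + t * h)) i)" for i
    by (cases "i = j") (auto intro!: continuous_intros)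
  then have "continuous_map (top_of_set {0..1}) (powertop_real UNIV) (\<lambda>t. v(j := v j + t * h))"
    by (simp only: continuous_map_componentwise_UNIV simp_thms)
  moreover have "v(j := v j + t * h) \<in> {x. \<forall>i\<ge>d. x i = 0}" if "t \<in> {0..1}" for t
    using assms(1)[OF that] assms(2) by (auto simp only: topspace_Euclidean_space)
  ultimately show ?thesis
    using assms(1) unfolding pathin_def continuous_map_in_subtopology Euclidean_space_def
    by (simp only: topspace_subtopology topspace_euclidean Int_UNIV_left image_subset_iff Pi_iff) blast
qed

lemma singular_imp_trivial_region:
  assumes "singular d P v" "P \<subseteq> RR d"
  shows "\<exists>l. genericity_region d P v \<subseteq> coord_flat d {..<d} l"
proof -
  let ?Q = "\<lambda>k. \<exists>I l. I \<subseteq> {..<d} \<and> k = d - card I \<and> genericity_region d P v \<subseteq> coord_flat d I l"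
  \<comment> \<open>\<open>LEAST\<close> is meaningful only once some value qualifies;
    \<open>I = {}\<close> supplies the value \<open>d\<close>.\<close>
  have "?Q d"
    using assms(2) by (intro exI[of _ "{}"]) (auto simp: coord_flat_def genericity_region_def)
  then have "?Q (degree_in d P v)" unfolding degree_in_def by (rule LeastI)
  then obtain I l where I: "I \<subseteq> {..<d}" "0 = d - card I"
      and l: "genericity_region d P v \<subseteq> coord_flat d I l"
    using assms(1) by (auto simp: singular_def)
  \<comment> \<open>Truncated subtraction gives only \<open>d \<le> card I\<close>; the inclusion in
    \<open>{..<d}\<close> does the rest.\<close>
  have "I = {..<d}" using I by (intro card_subset_eq) (auto intro: antisym card_mono[of "{..<d}", simplified])
  then show ?thesis using l by blast
qed

text \<open>Moving a non-extremal coordinate of \<open>v\<close> keeps the cone, so the genericity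
  region has two points that differ in that coordinate and fits in no flat of dimension 0. The local
  agreement of \<open>P\<close> with the box is assumed at every \<open>w\<close>, as cones are
  needed along a whole segment.\<close>

lemma singular_is_corner:
  assumes ab: "\<forall>i<d. a i < b i" and v: "v \<in> axis_box d a b" and "\<delta> > 0"
    and sub: "axis_box d a b \<subseteq> P" "P \<subseteq> RR d"
    and P: "\<And>w. w \<in> axis_box d a b \<Longrightarrow>
      P \<inter> translate w (cube d \<delta>) = axis_box d a b \<inter> translate w (cube d \<delta>)"
    and sing: "singular d P v"
  shows "\<forall>i<d. v i = a i \<or> v i = b i"
proof (rule ccontr)
  assume "\<not> ?thesis"
  then obtain j where j: "j < d" "v j \<noteq> a j" "v j \<noteq> b j" by blast
  with v have vj: "a j < v j" "v j < b j" by (force simp: axis_box_def)+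
  \<comment> \<open>Going half way to the upper facet keeps the entire segment strictly between the
    bounds.\<close>
  define h where "h = (b j - v j) / 2"
  define g where "g t = v(j := v j + t * h)" for t
  have h: "h > 0" "v j + h < b j" using vj by (auto simp: h_def field_simps)
  have gj: "a j < g t j" "g t j < b j" if "t \<in> {0..1}" for t
  proof -
    have "0 \<le> t * h" "t * h \<le> h" using that h by (auto simp: mult_left_le_one_le)
    then show "a j < g t j" "g t j < b j" using h vj unfolding g_def fun_upd_same by linarith+
  qed
  have g_box: "g t \<in> axis_box d a b" if "t \<in> {0..1}" for t
    using v gj[OF that] j by (auto simp: axis_box_def RR_iff g_def)
  have cone: "has_tangent_cone d P (g t) (box_cone d a b v)" if "t \<in> {0..1}" for t
  proof -
    \<comment> \<open>Coordinate \<open>j\<close> is never extremal on the segment, so the cones are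
      equal and the identity serves as congruence.\<close>
    have "box_cone d a b (g t) = box_cone d a b v"
      using gj[OF that] vj by (force simp: box_cone_def g_def)
    then show ?thesis
      using has_tangent_cone_box[OF ab g_box \<open>\<delta> > 0\<close> P] g_box that by metis
  qed
  have g0: "g 0 = v" by (simp add: g_def)
  have path: "pathin (subtopology (Euclidean_space d) P) g"
    using pathin_coordinate_segment[of v j h P] g_box sub by (auto simp: g_def[abs_def])
  have "g t \<in> genericity_region d P v" if t: "t \<in> {0, 1}" for t
  proof -
    \<comment> \<open>The rescaled path runs from \<open>v\<close> to \<open>g t\<close>: it is
      constant for \<open>t = 0\<close> and \<open>g\<close> itself for
      \<open>t = 1\<close>.\<close>
    have "pathin (subtopology (Euclidean_space d) P) (\<lambda>u. g (u * t))"
      using t path pathin_const[of "subtopology (Euclidean_space d) P" v] v sub g0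
      by (auto simp: axis_box_def)
    moreover have "u * t \<in> {0..1}" if "u \<in> {0..1}" for u :: real
      using t that by auto
    moreover have "g t \<in> P" using g_box[of t] t sub by auto
    ultimately show ?thesis
      unfolding genericity_region_def
      using cone g0 cone_congruent_refl[of d "box_cone d a b v"] cone[of 0]
      by (auto intro!: exI[of _ "\<lambda>u. g (u * t)"] exI[of _ "box_cone d a b v"])
  qed
  then have "g 0 \<in> genericity_region d P v" "g 1 \<in> genericity_region d P v" by auto
  moreover obtain l where "genericity_region d P v \<subseteq> coord_flat d {..<d} l"
    using singular_imp_trivial_region[OF sing sub(2)] by blast
  ultimately have "g 0 \<in> coord_flat d {..<d} l" "g 1 \<in> coord_flat d {..<d} l" by blast+
  then have "g 0 j = g 1 j" using j(1) unfolding coord_flat_def by simp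
  then show False using h by (simp add: g_def)
qed

section \<open>Unions of well-separated cubes\<close>

definition cube_at :: "nat \<Rightarrow> real \<Rightarrow> point \<Rightarrow> point set" where
  "cube_at d \<delta> p = axis_box d (\<lambda>i. p i - \<delta>) (\<lambda>i. p i + \<delta>)"

lemma generic_orthotope_cubes:
  assumes F: "finite F" and "\<delta> > 0"
    and sep: "\<forall>p\<in>F. \<forall>q\<in>F. p \<noteq> q \<longrightarrow> (\<exists>i<d. \<bar>p i - q i\<bar> > 3 * \<delta>)"
  shows "generic_orthotope d (\<Union>p\<in>F. cube_at d \<delta> p)"
proof -
  let ?P = "\<Union>p\<in>F. cube_at d \<delta> p"
  have "pure_orthogonal_polytope d ?P"
    unfolding pure_orthogonal_polytope_def
  proof (intro exI conjI)
    have "pure_box d (cube_at d \<delta> p)" for p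
      unfolding pure_box_def cube_at_def using \<open>\<delta> > 0\<close>
      by (intro exI conjI) auto
    then show "\<forall>B\<in>cube_at d \<delta> ` F. pure_box d B" by blast
  qed (use F in auto)
  moreover have "\<exists>\<alpha>. has_tangent_cone d ?P v \<alpha> \<and> floral_vertex d \<alpha>" if sing: "singular d ?P v" for v
  proof -
    obtain p where p: "p \<in> F" "v \<in> cube_at d \<delta> p" using sing by (auto simp: singular_def)
    let ?a = "\<lambda>i. p i - \<delta>" and ?b = "\<lambda>i. p i + \<delta>"
    have ab: "\<forall>i<d. ?a i < ?b i" using \<open>\<delta> > 0\<close> by simp
    have P: "?P \<inter> translate w (cube d \<delta>) = axis_box d ?a ?b \<inter> translate w (cube d \<delta>)"
      if w: "w \<in> axis_box d ?a ?b" for w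
    proof -
      have "q = p" if q: "q \<in> F" "y \<in> cube_at d \<delta> q" "y \<in> translate w (cube d \<delta>)" for q y
      proof (rule ccontr)
        assume "q \<noteq> p"
        then obtain i where i: "i < d" "\<bar>q i - p i\<bar> > 3 * \<delta>"
          using bspec[OF bspec[OF sep q(1)] p(1)] by blast
        \<comment> \<open>These three steps from \<open>q\<close> to \<open>p\<close> are the source
          of the constant 3: the neighbourhood of radius \<open>\<delta>\<close> of one cube meets
          no other cube.\<close>
        have "\<bar>y i - q i\<bar> \<le> \<delta>" "\<bar>y i - w i\<bar> \<le> \<delta>" "\<bar>w i - p i\<bar> \<le> \<delta>"
          using q w i by (auto simp: cube_at_def cube_def axis_box_def mem_translate_iff abs_le_iff
              algebra_simps)
        then show False using i by linarith
      qed
      then show ?thesis using p(1) unfolding cube_at_def by blast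
    qed
    have v: "v \<in> axis_box d ?a ?b" using p by (simp add: cube_at_def)
    have "axis_box d ?a ?b \<subseteq> ?P" using p(1) by (auto simp: cube_at_def)
    moreover have "?P \<subseteq> RR d" by (auto simp: cube_at_def axis_box_def)
    ultimately have "\<forall>i<d. v i = ?a i \<or> v i = ?b i"
      using singular_is_corner[OF ab v \<open>\<delta> > 0\<close> _ _ P sing] by blast
    then show ?thesis
      using has_tangent_cone_box[OF ab v \<open>\<delta> > 0\<close> P[OF v]] box_cone_corner[OF ab] by blast
  qed
  ultimately show ?thesis by (simp add: generic_orthotope_def)
qed

section \<open>Hausdorff bounds, finite nets and separation\<close>

lemma sup_norm_le_iff: "0 \<le> r \<Longrightarrow> sup_norm d x \<le> r \<longleftrightarrow> (\<forall>i<d. \<bar>x i\<bar> \<le> r)"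
  by (auto simp: sup_norm_def)

text \<open>One nearby point bounds each infimum. If one set is empty, the assumptions make the
  other empty too, and both suprema are 0.\<close>

lemma Hdist_le:
  assumes "0 \<le> r"
    and "\<And>x. x \<in> P \<Longrightarrow> \<exists>y\<in>Q. \<forall>i<d. \<bar>x i - y i\<bar> \<le> r"
    and "\<And>y. y \<in> Q \<Longrightarrow> \<exists>x\<in>P. \<forall>i<d. \<bar>y i - x i\<bar> \<le> r"
  shows "Hdist d P Q \<le> ennreal r"
proof -
  have "set_dist d x S \<le> ennreal r" if "\<exists>y\<in>S. \<forall>i<d. \<bar>x i - y i\<bar> \<le> r" for x S
  proof -
    from that obtain y where y: "y \<in> S" "\<forall>i<d. \<bar>x i - y i\<bar> \<le> r" by blast
    then have "sup_norm d (\<lambda>i. x i - y i) \<le> r" using sup_norm_le_iff[OF assms(1)] by simp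
    then show ?thesis unfolding set_dist_def
      using y by (intro INF_lower2[of y] ennreal_leI) auto
  qed
  then show ?thesis unfolding Hdist_def using assms(2,3) by (intro max.boundedI SUP_least) blast+
qed

lemma compactin_finite_net:
  assumes "compactin (Euclidean_space d) E" "r > 0"
  shows "\<exists>F\<subseteq>E. finite F \<and> (\<forall>x\<in>E. \<exists>p\<in>F. \<forall>i<d. \<bar>x i - p i\<bar> \<le> r)"
proof -
  \<comment> \<open>Balls of the sum norm: a finite sum is readily seen to be continuous, and it
    dominates each coordinate difference.\<close>
  define U where "U p = {x \<in> RR d. (\<Sum>i<d. \<bar>x i - p i\<bar>) \<in> {..<r}}" for p
  have E: "E \<subseteq> RR d" using assms(1) by (rule compactin_subset_topspace)
  have "openin (Euclidean_space d) (U p)" for p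
    unfolding U_def
  proof (rule openin_continuous_map_preimage)
    show "continuous_map (Euclidean_space d) euclideanreal (\<lambda>x. \<Sum>i<d. \<bar>x i - p i\<bar>)"
      unfolding Euclidean_space_def
      by (intro continuous_map_sum continuous_map_real_abs continuous_map_diff
          continuous_map_from_subtopology continuous_map_product_projection) auto
  qed auto
  moreover have "p \<in> U p" if "p \<in> E" for p
    using that E \<open>r > 0\<close> by (auto simp: U_def)
  then have "E \<subseteq> \<Union>(U ` E)" by blast
  ultimately obtain \<F> where "finite \<F>" "\<F> \<subseteq> U ` E" "E \<subseteq> \<Union>\<F>"
    using assms(1) unfolding compactin_def by (metis (no_types, lifting) imageE)
  then obtain F where F: "F \<subseteq> E" "finite F" "E \<subseteq> \<Union>(U ` F)"
    by (metis finite_subset_image)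
  have le: "\<bar>x i - p i\<bar> \<le> r" if "x \<in> U p" "i < d" for x p i
    using that member_le_sum[of i "{..<d}" "\<lambda>i. \<bar>x i - p i\<bar>"] by (force simp: U_def)
  have "\<exists>p\<in>F. \<forall>i<d. \<bar>x i - p i\<bar> \<le> r" if x: "x \<in> E" for x
  proof -
    obtain p where "p \<in> F" "x \<in> U p" using F(3) x by blast
    then show ?thesis using le[of x p] by (intro bexI[of _ p]) simp_all
  qed
  then show ?thesis using F(1,2) by (intro exI[of _ F]) simp
qed

lemma finite_separation:
  assumes "finite F" "F \<subseteq> RR d" "r > 0"
  shows "\<exists>\<delta>>0. \<delta> < r \<and> (\<forall>p\<in>F. \<forall>q\<in>F. p \<noteq> q \<longrightarrow> (\<exists>i<d. \<bar>p i - q i\<bar> > 3 * \<delta>))"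
proof -
  have "\<forall>\<^sub>F \<delta> in at_right 0. p \<noteq> q \<longrightarrow> (\<exists>i<d. \<bar>p i - q i\<bar> > 3 * \<delta>)"
    if "p \<in> F" "q \<in> F" for p q
  proof (cases "p = q")
    case False
    then obtain i where i: "p i \<noteq> q i" by blast
    \<comment> \<open>Both points vanish at all indices from \<open>d\<close> on, so they can differ
      only below \<open>d\<close>.\<close>
    then have "i < d" using that assms(2) by (metis RR_iff linorder_not_less subsetD)
    have "\<forall>\<^sub>F \<delta> in at_right 0. \<delta> \<in> {0<..<\<bar>p i - q i\<bar> / 3}"
      using i by (intro eventually_at_right_real) simp
    then show ?thesis by eventually_elim (use \<open>i < d\<close> in auto)
  qed simp
  then have "\<forall>\<^sub>F \<delta> in at_right 0. \<forall>p\<in>F. \<forall>q\<in>F. p \<noteq> q \<longrightarrow> (\<exists>i<d. \<bar>p i - q i\<bar> > 3 * \<delta>)"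
    using assms(1) by (simp add: eventually_ball_finite_distrib)
  moreover have "\<forall>\<^sub>F \<delta> in at_right 0. \<delta> \<in> {0<..<r}"
    using \<open>r > 0\<close> by (rule eventually_at_right_real)
  ultimately have "\<forall>\<^sub>F \<delta> in at_right 0. \<delta> \<in> {0<..<r} \<and>
      (\<forall>p\<in>F. \<forall>q\<in>F. p \<noteq> q \<longrightarrow> (\<exists>i<d. \<bar>p i - q i\<bar> > 3 * \<delta>))"
    by eventually_elim auto
  from eventually_happens'[OF trivial_limit_at_right_real this] show ?thesis
    by auto
qed

theorem theorem4p5:
  fixes d :: nat and E :: "(nat \<Rightarrow> real) set" and \<epsilon> :: real
  assumes "compactin (Euclidean_space d) E" and "\<epsilon> > 0"
  shows "\<exists>P. generic_orthotope d P \<and> Hdist d E P < ennreal \<epsilon>"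
proof -
  \<comment> \<open>\<open>Hdist_le\<close> yields a non-strict bound, so a radius strictly below
    \<open>\<epsilon>\<close> is fixed first.\<close>
  define r where "r = \<epsilon> / 2"
  have r: "0 < r" "r < \<epsilon>" using assms(2) by (auto simp: r_def)
  from compactin_finite_net[OF assms(1) r(1)]
  obtain F where F: "F \<subseteq> E" "finite F" and net: "\<forall>x\<in>E. \<exists>p\<in>F. \<forall>i<d. \<bar>x i - p i\<bar> \<le> r"
    by (elim exE conjE)
  have FR: "F \<subseteq> RR d" using F(1) compactin_subset_topspace[OF assms(1)] by blast
  from finite_separation[OF F(2) FR r(1)]
  obtain \<delta> where \<delta>: "\<delta> > 0" "\<delta> < r"
      and sep: "\<forall>p\<in>F. \<forall>q\<in>F. p \<noteq> q \<longrightarrow> (\<exists>i<d. \<bar>p i - q i\<bar> > 3 * \<delta>)"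
    by (elim exE conjE)
  let ?P = "\<Union>p\<in>F. cube_at d \<delta> p"
  \<comment> \<open>The net lies in both sets: points of \<open>E\<close> are near a cube centre,
    and points of a cube are within \<open>\<delta> < r\<close> of its centre, which belongs to
    \<open>E\<close>.\<close>
  have "Hdist d E ?P \<le> ennreal r"
  proof (rule Hdist_le)
    fix x assume "x \<in> E"
    have "p \<in> cube_at d \<delta> p" if "p \<in> F" for p
      using that FR \<delta>(1) by (auto simp: cube_at_def axis_box_def)
    then show "\<exists>y\<in>?P. \<forall>i<d. \<bar>x i - y i\<bar> \<le> r" using bspec[OF net \<open>x \<in> E\<close>] by blast
  next
    fix y assume "y \<in> ?P"
    then obtain p where p: "p \<in> F" "y \<in> cube_at d \<delta> p" by blast
    have "\<bar>y i - p i\<bar> \<le> r" if "i < d" for i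
    proof -
      have "p i - \<delta> \<le> y i" "y i \<le> p i + \<delta>"
        using p(2) that by (simp_all add: cube_at_def axis_box_def)
      then show ?thesis using \<delta>(2) by linarith
    qed
    then show "\<exists>x\<in>E. \<forall>i<d. \<bar>y i - x i\<bar> \<le> r" using p(1) F(1) by blast
  qed (use r in simp)
  also have "ennreal r < ennreal \<epsilon>" using r by (simp add: ennreal_lessI)
  finally show ?thesis using generic_orthotope_cubes[OF F(2) \<delta>(1) sep] by blast
qed

end
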